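(* Let $\mathcal{A}$ be a commutative, associative, unital, finite-dimensional real algebra and $n\ge1$. Suppose $a_0,a_1,\dots,a_n:I\to\mathcal{A}$ are continuous functions on the connected open set $I\subseteq\mathcal{A}$, where $a_0(z)\in\mathcal{A}^\times$ for each $z\in I$. If $y_1,\dots,y_n:I\to\mathcal{A}$ are solutions on $I$ of $$a_0y^{(n)}+a_1y^{(n-1)}+\cdots+a_{n-1}y'+a_ny=0,$$ then $$W(y_1,\dots,y_n;z)=C\exp\left[-\int\frac{a_1}{a_0}\,dz\right]\quad\text{for each } z\in I,$$ for some constant $C\in\mathcal{A}$; here $\int\frac{a_1}{a_0}\,dz$ denotes an $\mathcal{A}$-antiderivative of $a_1/a_0$ on $I$. That is, if $F:I\to\mathcal{A}$ is $\mathcal{A}$-differentiable with $F'=a_1/a_0$ on $I$, then there is $C\in\mathcal{A}$ with $W(y_1,\dots,y_n;z)=C\exp(-F(z))$ for all $z\in I$.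
   Context: $\mathcal{A}^\times$ is the group of units of $\mathcal{A}$; multiplication is by juxtaposition. For $U\subseteq\mathcal{A}$ open, $f:U\to\mathcal{A}$ is $\mathcal{A}$-differentiable at $p$ if there is a real-linear map $d_pf:\mathcal{A}\to\mathcal{A}$ with $d_pf(xy)=d_pf(x)y$ for all $x,y\in\mathcal{A}$ and $\lim_{h\to0}\frac{f(p+h)-f(p)-d_pf(h)}{\|h\|}=0$ (any norm on $\mathcal{A}$); then $f'(p)=d_pf(1)$, and $f^{(k)}=(f^{(k-1)})'$. A solution is an $n$-times $\mathcal{A}$-differentiable function satisfying the equation on $I$. The Wronskian $W(y_1,\dots,y_n;z)$ is the determinant (over the commutative ring $\mathcal{A}$) of the $n\times n$ matrix with $(i,j)$ entry $y_j^{(i-1)}(z)$. The exponential on $\mathcal{A}$ is $\exp(\zeta)=\sum_{m\ge0}\zeta^m/m!$. *)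

theory Defs
  imports "HOL-Analysis.Analysis" "Jordan_Normal_Form.Determinant"
begin

text \<open>
  The algebra is a type of sort \<open>{euclidean_space, real_algebra_1, comm_ring_1}\<close>: a commutative,
  associative, unital (with \<open>1 \<noteq> 0\<close>) real algebra of finite dimension.  The inner product of
  \<open>euclidean_space\<close> merely supplies one of the equivalent norms; no compatibility with the
  multiplication is assumed.  In particular the sort must not contain \<open>real_normed_algebra_1\<close>:
  a submultiplicative Euclidean norm with \<open>norm 1 = 1\<close> exists only on the real and the complex
  numbers.  For the same reason the exponential series is written out below, as the library
  constant \<open>exp\<close> requires that class.
\<close>

definition has_alg_derivative ::
    "('a::{euclidean_space, real_algebra_1, comm_ring_1} \<Rightarrow> 'a) \<Rightarrow> ('a \<Rightarrow> 'a) \<Rightarrow> 'a \<Rightarrow> bool" where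
  "has_alg_derivative f d p \<longleftrightarrow> (f has_derivative d) (at p) \<and> (\<forall>x y. d (x * y) = d x * y)"

definition alg_differentiable ::
    "('a::{euclidean_space, real_algebra_1, comm_ring_1} \<Rightarrow> 'a) \<Rightarrow> 'a \<Rightarrow> bool" where
  "alg_differentiable f p \<longleftrightarrow> (\<exists>d. has_alg_derivative f d p)"

text \<open>Only meaningful where \<open>f\<close> is \<open>alg_differentiable\<close>.\<close>

definition alg_deriv ::
    "('a::{euclidean_space, real_algebra_1, comm_ring_1} \<Rightarrow> 'a) \<Rightarrow> 'a \<Rightarrow> 'a" where
  "alg_deriv f p = frechet_derivative f (at p) 1"

lemma alg_deriv_eq: "has_alg_derivative f d p \<Longrightarrow> alg_deriv f p = d 1"
  unfolding has_alg_derivative_def alg_deriv_def using frechet_derivative_at by metis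

text \<open>
  Functions on an open set are total functions whose values outside the set are irrelevant:
  for \<open>p\<close> in an open set, the iterated derivatives at \<open>p\<close> depend only on the values on that set.
\<close>

definition alg_differentiable_times ::
    "nat \<Rightarrow> ('a::{euclidean_space, real_algebra_1, comm_ring_1} \<Rightarrow> 'a) \<Rightarrow> 'a set \<Rightarrow> bool" where
  "alg_differentiable_times n f U \<longleftrightarrow>
     (\<forall>k<n. \<forall>p\<in>U. alg_differentiable ((alg_deriv ^^ k) f) p)"

definition linear_ode_solution ::
    "nat \<Rightarrow> (nat \<Rightarrow> 'a \<Rightarrow> 'a) \<Rightarrow> 'a set
      \<Rightarrow> ('a::{euclidean_space, real_algebra_1, comm_ring_1} \<Rightarrow> 'a) \<Rightarrow> bool" where
  "linear_ode_solution n a U y \<longleftrightarrow>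
     alg_differentiable_times n y U \<and>
     (\<forall>z\<in>U. (\<Sum>k\<le>n. a k z * (alg_deriv ^^ (n - k)) y z) = 0)"

text \<open>
  Matrix indices start at \<open>0\<close>, whereas the functions are \<open>y 1, \<dots>, y n\<close>.
\<close>

definition wronskian ::
    "nat \<Rightarrow> (nat \<Rightarrow> 'a \<Rightarrow> 'a) \<Rightarrow> 'a::{euclidean_space, real_algebra_1, comm_ring_1} \<Rightarrow> 'a" where
  "wronskian n y z = Determinant.det (mat n n (\<lambda>(i, j). (alg_deriv ^^ i) (y (Suc j)) z))"

definition alg_exp :: "'a::{euclidean_space, real_algebra_1, comm_ring_1} \<Rightarrow> 'a" where
  "alg_exp x = (\<Sum>m. (1 / fact m) *\<^sub>R x ^ m)"

text \<open>Only meaningful for units.\<close>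

definition alg_inverse :: "'a::comm_ring_1 \<Rightarrow> 'a" where
  "alg_inverse x = (THE w. x * w = 1)"

lemma alg_inverse_unit: "x * alg_inverse x = 1" if "x dvd 1"
proof -
  obtain w where w: "x * w = 1" using \<open>x dvd 1\<close> by (metis dvdE)
  have "v = w" if "x * v = 1" for v
    using w that by (metis mult.assoc mult.commute mult_1_right)
  then show ?thesis
    unfolding alg_inverse_def using theI[of "\<lambda>w. x * w = 1"] w by blast
qed

end

theory Submission imports Defs begin

text \<open>
  Differentiating the Wronskian row by row gives a sum of determinants, all of which but the last
  have two equal rows; in the last one, the equation turns the bottom row into
  \<open>- a\<^sub>1 / a\<^sub>0\<close> times the bottom row of the Wronskian plus multiples of the other rows.  So
  \<open>W' = - (a\<^sub>1 / a\<^sub>0) W\<close>, and \<open>W * exp F\<close> has zero derivative on the connected open set.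
  Neither step divides by anything but \<open>a\<^sub>0\<close>, so zero divisors of the algebra do no harm.
\<close>

section \<open>Calculus in the algebra\<close>

text \<open>Finite dimension makes every bilinear map bounded. This replaces submultiplicativity of
  the norm, which is not assumed, and opens the product rule of real analysis to the
  algebra.\<close>

lemma bounded_bilinear_alg_mult:
  "bounded_bilinear ((*) :: 'a::{euclidean_space, real_algebra_1, comm_ring_1} \<Rightarrow> 'a \<Rightarrow> 'a)"
  unfolding bilinear_conv_bounded_bilinear[symmetric] bilinear_def
  by (auto intro!: linearI simp: algebra_simps)

text \<open>Since \<open>d x = d (1 * x) = d 1 * x\<close>, an algebra-linear map is multiplication
  by its value at 1. All later derivatives are therefore real derivatives that happen to be
  multiplication operators.\<close>

lemma has_alg_derivative_iff:
  "has_alg_derivative f d p \<longleftrightarrow> (f has_derivative (*) (alg_deriv f p)) (at p) \<and> d = (*) (alg_deriv f p)"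
proof
  assume d: "has_alg_derivative f d p"
  then have "d x = alg_deriv f p * x" for x
    by (metis alg_deriv_eq has_alg_derivative_def mult_1)
  then have "d = (*) (alg_deriv f p)" by (rule ext)
  then show "(f has_derivative (*) (alg_deriv f p)) (at p) \<and> d = (*) (alg_deriv f p)"
    using d by (simp add: has_alg_derivative_def)
next
  assume "(f has_derivative (*) (alg_deriv f p)) (at p) \<and> d = (*) (alg_deriv f p)"
  then show "has_alg_derivative f d p"
    by (simp add: has_alg_derivative_def mult.assoc)
qed

lemma alg_differentiable_iff:
  "alg_differentiable f p \<longleftrightarrow> (f has_derivative (*) (alg_deriv f p)) (at p)"
  by (simp add: alg_differentiable_def has_alg_derivative_iff)

lemma has_derivative_alg_mult:
  fixes f g :: "'b::real_normed_vector \<Rightarrow> 'a::{euclidean_space, real_algebra_1, comm_ring_1}"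
  assumes "(f has_derivative f') (at x)" and "(g has_derivative g') (at x)"
  shows "((\<lambda>x. f x * g x) has_derivative (\<lambda>h. f x * g' h + f' h * g x)) (at x)"
  by (rule bounded_bilinear.FDERIV[OF bounded_bilinear_alg_mult assms])

lemma has_derivative_alg_prod:
  fixes f :: "'i \<Rightarrow> 'a \<Rightarrow> 'a::{euclidean_space, real_algebra_1, comm_ring_1}"
  assumes "finite S" and "\<And>i. i \<in> S \<Longrightarrow> (f i has_derivative (*) (f' i)) (at x)"
  shows "((\<lambda>x. \<Prod>i\<in>S. f i x) has_derivative (*) (\<Sum>k\<in>S. f' k * (\<Prod>i\<in>S - {k}. f i x))) (at x)"
  using assms
proof (induction S rule: finite_induct)
  case empty
  have "(*) (0::'a) = (\<lambda>h. 0)" by auto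
  then show ?case by simp
next
  case (insert j S)
  have "(\<Sum>k\<in>S. f' k * (\<Prod>i\<in>insert j S - {k}. f i x))
      = (\<Sum>k\<in>S. f j x * (f' k * (\<Prod>i\<in>S - {k}. f i x)))"
  proof (rule sum.cong)
    fix k assume "k \<in> S"
    then have "insert j S - {k} = insert j (S - {k})" using insert by auto
    then show "f' k * (\<Prod>i\<in>insert j S - {k}. f i x) = f j x * (f' k * (\<Prod>i\<in>S - {k}. f i x))"
      using insert by (simp add: algebra_simps)
  qed simp
  moreover have "((\<lambda>x. f j x * (\<Prod>i\<in>S. f i x)) has_derivative
      (\<lambda>h. f j x * ((\<Sum>k\<in>S. f' k * (\<Prod>i\<in>S - {k}. f i x)) * h) + f' j * h * (\<Prod>i\<in>S. f i x))) (at x)"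
    using insert by (intro has_derivative_alg_mult) auto
  ultimately show ?case
    using insert by (simp add: algebra_simps sum_distrib_left)
qed

text \<open>A power is a product of \<open>m\<close> copies of the identity. For
  \<open>m = 0\<close> the truncated exponent \<open>m - 1\<close> is harmless because of the factor
  \<open>of_nat m\<close>.\<close>

lemma has_derivative_alg_power:
  fixes x :: "'a::{euclidean_space, real_algebra_1, comm_ring_1}"
  shows "((\<lambda>x. x ^ m) has_derivative (*) (of_nat m * x ^ (m - 1))) (at x)"
proof -
  have "(*) (1::'a) = (\<lambda>h. h)" by auto
  then show ?thesis
    using has_derivative_alg_prod[of "{..<m}" "\<lambda>_ x. x" "\<lambda>_. 1" x] by simp
qed

section \<open>The exponential function of the algebra\<close>

text \<open>Each further factor of a power costs one bound \<open>K\<close> of the multiplication.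
  The factor \<open>norm 1\<close> remains because 1 need not have norm one.\<close>

lemma alg_norm_power_bound:
  obtains K where "K > 0"
    and "\<And>x y :: 'a::{euclidean_space, real_algebra_1, comm_ring_1}. norm (x * y) \<le> K * norm x * norm y"
    and "\<And>(x::'a) m. norm (x ^ m) \<le> norm (1::'a) * (K * norm x) ^ m"
proof -
  obtain K where K: "K > 0" "\<And>x y :: 'a. norm (x * y) \<le> norm x * norm y * K"
    using bounded_bilinear.pos_bounded[OF bounded_bilinear_alg_mult] by blast
  have "norm (x ^ m) \<le> norm (1::'a) * (K * norm x) ^ m" for x :: 'a and m
  proof (induction m)
    case (Suc m)
    have "norm (x ^ Suc m) \<le> (norm x * K) * norm (x ^ m)"
      using K(2)[of x "x ^ m"] by (simp add: mult_ac)
    also have "\<dots> \<le> (norm x * K) * (norm (1::'a) * (K * norm x) ^ m)"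
      using Suc K(1) by (intro mult_left_mono) auto
    finally show ?case by (simp add: mult_ac)
  qed simp
  then show thesis using that K by (simp add: mult_ac)
qed

text \<open>Weierstrass M-test: on the ball the terms are dominated by those of the real exponential
  series at \<open>K * R\<close>, up to the factor \<open>norm 1\<close>.\<close>

lemma alg_exp_uniform_limit:
  "uniform_limit (ball (0::'a::{euclidean_space, real_algebra_1, comm_ring_1}) R)
     (\<lambda>n x. \<Sum>m<n. (1 / fact m) *\<^sub>R x ^ m) alg_exp sequentially"
proof -
  obtain K where K: "K > 0" "\<And>(x::'a) m. norm (x ^ m) \<le> norm (1::'a) * (K * norm x) ^ m"
    using alg_norm_power_bound by metis
  have "norm ((1 / fact m) *\<^sub>R x ^ m) \<le> norm (1::'a) * (inverse (fact m) * (K * R) ^ m)"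
    if "x \<in> ball 0 R" for x :: 'a and m
  proof -
    have "norm (x ^ m) \<le> norm (1::'a) * (K * R) ^ m"
      using that K by (intro order_trans[OF K(2)] mult_left_mono power_mono) auto
    then show ?thesis by (simp add: field_simps)
  qed
  moreover have "summable (\<lambda>m. norm (1::'a) * (inverse (fact m) * (K * R) ^ m))"
    by (intro summable_mult summable_exp)
  ultimately show ?thesis
    unfolding alg_exp_def by (rule Weierstrass_m_test)
qed

lemma alg_exp_sums: "(\<lambda>m. (1 / fact m) *\<^sub>R x ^ m) sums alg_exp x"
  using tendsto_uniform_limitI[OF alg_exp_uniform_limit, of x "norm x + 1"] by (simp add: sums_def)

lemma alg_exp_0: "alg_exp 0 = 1"
proof -
  have "(\<lambda>m. (1 / fact m) *\<^sub>R (0::'a) ^ m) = (\<lambda>m. if m = 0 then 1 else 0)"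
    by (auto simp: power_0_left)
  then show ?thesis
    using sums_single[of 0 "\<lambda>_. 1::'a"] alg_exp_sums[of "0::'a"] sums_unique2 by fastforce
qed

text \<open>Termwise differentiation: the differentiated series is the original one shifted by one
  index, so it also converges uniformly on balls.\<close>

lemma has_derivative_alg_exp: "(alg_exp has_derivative (*) (alg_exp x)) (at x)"
proof -
  define e :: "nat \<Rightarrow> 'a \<Rightarrow> 'a" where "e = (\<lambda>m x. (1 / fact m) *\<^sub>R x ^ m)"
  \<comment> \<open>The constant term has derivative 0, and
    \<open>m / fact m = 1 / fact (m - 1)\<close> turns every other term into its
    predecessor.\<close>
  define e' :: "nat \<Rightarrow> 'a \<Rightarrow> 'a" where "e' = (\<lambda>m x. case m of 0 \<Rightarrow> 0 | Suc k \<Rightarrow> e k x)"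
  define S where "S = ball (0::'a) (norm x + 1)"
  have x: "x \<in> S" "open S" by (auto simp: S_def)
  have e_sums: "(\<lambda>n. e n z) sums alg_exp z" for z
    unfolding e_def by (rule alg_exp_sums)
  obtain K where K: "K > 0" "\<And>x y :: 'a. norm (x * y) \<le> K * norm x * norm y"
    using alg_norm_power_bound by metis
  have deriv: "(e m has_derivative (*) (e' m z)) (at z within S)" for m z
  proof -
    have "(e m has_derivative (\<lambda>h. (1 / fact m) *\<^sub>R (of_nat m * z ^ (m - 1) * h))) (at z within S)"
      unfolding e_def
      by (intro has_derivative_scaleR_right has_derivative_at_withinI[OF has_derivative_alg_power])
    moreover have "(1 / fact m) *\<^sub>R (of_nat m * z ^ (m - 1) * h) = e' m z * h" for h
    proof (cases m)
      case (Suc k)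
      have "of_nat m * z ^ (m - 1) * h = real m *\<^sub>R (z ^ (m - 1) * h)"
        by (simp add: scaleR_conv_of_real mult.assoc)
      then show ?thesis
        by (simp add: Suc e_def e'_def field_simps del: of_nat_Suc)
    qed (simp add: e'_def)
    ultimately show ?thesis by simp
  qed
  have lim: "uniform_limit S (\<lambda>n x. \<Sum>i<n. e i x) alg_exp sequentially"
    unfolding S_def e_def by (rule alg_exp_uniform_limit)
  \<comment> \<open>Uniform convergence of the derivatives as linear operators, as termwise
    differentiation demands. Accuracy \<open>\<epsilon> / K\<close> of the partial sums suffices,
    since multiplying by \<open>h\<close> costs a factor \<open>K\<close>.\<close>
  have close: "\<forall>\<^sub>F n in sequentially. \<forall>z\<in>S. \<forall>h. norm ((\<Sum>i<n. e' i z * h) - alg_exp z * h) \<le> \<epsilon> * norm h"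
    if "\<epsilon> > 0" for \<epsilon>
  proof -
    have "\<forall>\<^sub>F n in sequentially. \<forall>z\<in>S. dist (\<Sum>i<n. e i z) (alg_exp z) < \<epsilon> / K"
      using uniform_limitD[OF lim] that K by simp
    \<comment> \<open>The index is \<open>Suc n\<close> because the first \<open>Suc n\<close> terms
      of \<open>e'\<close> are a zero followed by the first \<open>n\<close> terms of
      \<open>e\<close>.\<close>
    then have "\<forall>\<^sub>F n in sequentially. \<forall>z\<in>S. \<forall>h.
      norm ((\<Sum>i<Suc n. e' i z * h) - alg_exp z * h) \<le> \<epsilon> * norm h"
    proof eventually_elim
      case (elim n)
      show ?case
      proof (intro ballI allI)
        fix z h assume z: "z \<in> S"
        have "(\<Sum>i<Suc n. e' i z * h) - alg_exp z * h = ((\<Sum>i<n. e i z) - alg_exp z) * h"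
          by (subst sum.lessThan_Suc_shift) (simp add: e'_def sum_distrib_right left_diff_distrib)
        also have "norm \<dots> \<le> K * norm ((\<Sum>i<n. e i z) - alg_exp z) * norm h"
          by (rule K)
        also have "\<dots> \<le> \<epsilon> * norm h"
          using elim z K(1) by (intro mult_right_mono) (auto simp: dist_norm field_simps less_imp_le)
        finally show "norm ((\<Sum>i<Suc n. e' i z * h) - alg_exp z * h) \<le> \<epsilon> * norm h" .
      qed
    qed
    then show ?thesis by (rule eventually_sequentially_Suc[THEN iffD1])
  qed
  have "\<exists>g. \<forall>z\<in>S. (\<lambda>n. e n z) sums g z \<and> (g has_derivative (*) (alg_exp z)) (at z within S)"
  proof (rule has_derivative_series[of S e "\<lambda>i z. (*) (e' i z)" _ x])
    show "convex S" by (simp add: S_def)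
  qed (use deriv x(1) e_sums close in auto)
  then obtain g where g: "\<And>z. z \<in> S \<Longrightarrow> (\<lambda>n. e n z) sums g z"
      "\<And>z. z \<in> S \<Longrightarrow> (g has_derivative (*) (alg_exp z)) (at z within S)"
    by blast
  \<comment> \<open>Termwise differentiation yields only some limit function \<open>g\<close>;
    uniqueness of sums identifies it.\<close>
  have "g z = alg_exp z" if "z \<in> S" for z
    using g(1)[OF that] e_sums sums_unique2 by blast
  moreover have "(g has_derivative (*) (alg_exp x)) (at x)"
    using g(2)[OF x(1)] unfolding at_within_open[OF x] .
  ultimately show ?thesis
    using has_derivative_transform_within_open x by blast
qed

text \<open>The product has zero derivative on the whole space, so it equals its value at 0. No
  addition formula is involved.\<close>

lemma alg_exp_mult_minus: "alg_exp x * alg_exp (- x) = 1"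
proof -
  have "((\<lambda>x. alg_exp x * alg_exp (- x)) has_derivative (\<lambda>h. 0)) (at z)" for z :: 'a
  proof -
    have "((\<lambda>x. alg_exp (- x)) has_derivative (\<lambda>h. alg_exp (- z) * - h)) (at z)"
      by (intro has_derivative_compose[of uminus, OF _ has_derivative_alg_exp] derivative_intros)
    from has_derivative_alg_mult[OF has_derivative_alg_exp this]
    show ?thesis by (simp add: algebra_simps)
  qed
  from has_derivative_zero_unique_connected[OF open_UNIV connected_UNIV this UNIV_I UNIV_I, of x 0]
  show ?thesis by (simp add: alg_exp_0)
qed

section \<open>Determinants and their derivatives\<close>

text \<open>Isolating the factor from row \<open>r\<close> in the Leibniz formula exposes the linear
  dependence on \<open>R\<close>; this serves both row linearity and differentiation.\<close>

lemma det_row_expand: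
  fixes A :: "nat \<Rightarrow> nat \<Rightarrow> 'a::comm_ring_1"
  assumes "r < n"
  shows "Determinant.det (mat n n (\<lambda>(i, j). if i = r then R j else A i j))
    = (\<Sum>p | p permutes {0..<n}. signof p * (R (p r) * (\<Prod>i\<in>{0..<n} - {r}. A i (p i))))"
  unfolding det_def'[OF mat_carrier]
proof (rule sum.cong)
  fix p assume "p \<in> {p. p permutes {0..<n}}"
  then have p: "\<And>i. i < n \<Longrightarrow> p i < n" by (auto dest: permutes_in_image)
  show "signof p * (\<Prod>i = 0..<n. mat n n (\<lambda>(i, j). if i = r then R j else A i j) $$ (i, p i))
     = signof p * (R (p r) * (\<Prod>i\<in>{0..<n} - {r}. A i (p i)))"
    using assms p by (simp add: prod.remove[of "{0..<n}" r])
qed simp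

lemma det_row_linear:
  fixes A :: "nat \<Rightarrow> nat \<Rightarrow> 'a::comm_ring_1"
  assumes "r < n"
  shows "Determinant.det (mat n n (\<lambda>(i, j). if i = r then \<Sum>k\<in>S. c k * R k j else A i j))
    = (\<Sum>k\<in>S. c k * Determinant.det (mat n n (\<lambda>(i, j). if i = r then R k j else A i j)))"
proof -
  define P where "P p = (\<Prod>i\<in>{0..<n} - {r}. A i (p i))" for p
  have "(\<Sum>p | p permutes {0..<n}. signof p * ((\<Sum>k\<in>S. c k * R k (p r)) * P p))
      = (\<Sum>p | p permutes {0..<n}. \<Sum>k\<in>S. c k * (signof p * (R k (p r) * P p)))"
    unfolding sum_distrib_left sum_distrib_right by (simp only: mult_ac)
  also have "\<dots> = (\<Sum>k\<in>S. c k * (\<Sum>p | p permutes {0..<n}. signof p * (R k (p r) * P p)))"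
    unfolding sum_distrib_left by (rule sum.swap)
  finally show ?thesis
    unfolding det_row_expand[OF assms] P_def .
qed

lemma det_row_duplicate:
  fixes A :: "nat \<Rightarrow> nat \<Rightarrow> 'a::comm_ring_1"
  assumes "r < n" and "s < n" and "r \<noteq> s"
  shows "Determinant.det (mat n n (\<lambda>(i, j). if i = r then A s j else A i j)) = 0"
  using assms by (intro det_identical_rows[of _ n r s]) (auto simp: row_def)

text \<open>Apply the product rule to each term of the Leibniz formula, then exchange the sums over
  permutations and rows: the terms belonging to a fixed row \<open>k\<close> form the determinant
  with that row differentiated.\<close>

lemma has_derivative_det:
  fixes A :: "nat \<Rightarrow> nat \<Rightarrow> 'a \<Rightarrow> 'a::{euclidean_space, real_algebra_1, comm_ring_1}"
  assumes "\<And>i j. i < n \<Longrightarrow> j < n \<Longrightarrow> (A i j has_derivative (*) (A' i j)) (at x)"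
  shows "((\<lambda>x. Determinant.det (mat n n (\<lambda>(i, j). A i j x))) has_derivative
    (*) (\<Sum>k<n. Determinant.det (mat n n (\<lambda>(i, j). if i = k then A' i j else A i j x)))) (at x)"
proof -
  define D where "D p = (\<Sum>k\<in>{0..<n}. A' k (p k) * (\<Prod>i\<in>{0..<n} - {k}. A i (p i) x))" for p
  have "((\<lambda>x. signof p * (\<Prod>i\<in>{0..<n}. A i (p i) x)) has_derivative (\<lambda>h. signof p * (D p * h))) (at x)"
    if "p permutes {0..<n}" for p
  proof -
    have "((\<lambda>x. \<Prod>i\<in>{0..<n}. A i (p i) x) has_derivative (*) (D p)) (at x)"
      unfolding D_def using that
      by (intro has_derivative_alg_prod assms) (auto dest: permutes_in_image)
    from has_derivative_alg_mult[OF has_derivative_const this, of "signof p"] show ?thesis by simp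
  qed
  then have "((\<lambda>x. \<Sum>p | p permutes {0..<n}. signof p * (\<Prod>i\<in>{0..<n}. A i (p i) x)) has_derivative
      (\<lambda>h. \<Sum>p | p permutes {0..<n}. signof p * (D p * h))) (at x)"
    by (intro has_derivative_sum) auto
  moreover have "(\<Sum>p | p permutes {0..<n}. signof p * (\<Prod>i\<in>{0..<n}. A i (p i) z))
      = Determinant.det (mat n n (\<lambda>(i, j). A i j z))" for z
    unfolding det_def'[OF mat_carrier]
  proof (intro sum.cong refl arg_cong2[of _ _ _ _ "(*)"] prod.cong)
    fix p i assume "p \<in> {p. p permutes {0..<n}}" "i \<in> {0..<n}"
    then have "i < n" "p i < n" by (auto dest: permutes_in_image)
    then show "A i (p i) z = mat n n (\<lambda>(i, j). A i j z) $$ (i, p i)" by simp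
  qed
  moreover have "(\<Sum>k<n. Determinant.det (mat n n (\<lambda>(i, j). if i = k then A' i j else A i j x)))
      = (\<Sum>p | p permutes {0..<n}. signof p * D p)"
  proof -
    \<comment> \<open>Writing \<open>A' k j\<close> for \<open>A' i j\<close> makes the inserted row
      a function of the column alone, the shape that \<open>det_row_expand\<close> requires.\<close>
    have "Determinant.det (mat n n (\<lambda>(i, j). if i = k then A' i j else A i j x))
        = Determinant.det (mat n n (\<lambda>(i, j). if i = k then A' k j else A i j x))" for k
      by (intro arg_cong[of _ _ Determinant.det] eq_matI) auto
    then have "(\<Sum>k<n. Determinant.det (mat n n (\<lambda>(i, j). if i = k then A' i j else A i j x)))
        = (\<Sum>k\<in>{0..<n}. \<Sum>p | p permutes {0..<n}.
            signof p * (A' k (p k) * (\<Prod>i\<in>{0..<n} - {k}. A i (p i) x)))"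
      unfolding atLeast0LessThan by (intro sum.cong refl) (simp add: det_row_expand atLeast0LessThan)
    also have "\<dots> = (\<Sum>p | p permutes {0..<n}. signof p * D p)"
      unfolding D_def sum_distrib_left by (rule sum.swap)
    finally show ?thesis .
  qed
  moreover have "(\<lambda>h. \<Sum>p | p permutes {0..<n}. signof p * (D p * h))
      = (*) (\<Sum>p | p permutes {0..<n}. signof p * D p)"
    by (simp add: fun_eq_iff sum_distrib_right mult.assoc)
  ultimately show ?thesis by simp
qed

section \<open>Abel's formula\<close>

lemma has_derivative_wronskian:
  fixes y :: "nat \<Rightarrow> 'a \<Rightarrow> 'a::{euclidean_space, real_algebra_1, comm_ring_1}"
  assumes "n \<ge> 1" and "a 0 z dvd 1" and z: "z \<in> I"
    and sol: "\<And>j. 1 \<le> j \<Longrightarrow> j \<le> n \<Longrightarrow> linear_ode_solution n a I (y j)"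
  shows "(wronskian n y has_derivative (*) (- (a 1 z * alg_inverse (a 0 z)) * wronskian n y z)) (at z)"
proof -
  define w where "w = alg_inverse (a 0 z)"
  define Y where "Y i j = (alg_deriv ^^ i) (y (Suc j)) z" for i j
  define M where "M k R = Determinant.det (mat n n (\<lambda>(i, j). if i = k then R j else Y i j))" for k R
  \<comment> \<open>These are the coefficients of the equation solved for the highest derivative:
    \<open>Y n j\<close> is the sum of \<open>c k * Y (n - k) j\<close> over \<open>k\<close> from 1
    to \<open>n\<close>.\<close>
  define c where "c k = - (w * a k z)" for k
  have "((\<lambda>z. Determinant.det (mat n n (\<lambda>(i, j). (alg_deriv ^^ i) (y (Suc j)) z))) has_derivative
      (*) (\<Sum>k<n. Determinant.det (mat n n (\<lambda>(i, j). if i = k then Y (Suc i) j else Y i j)))) (at z)"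
    unfolding Y_def
  proof (rule has_derivative_det)
    fix i j assume "i < n" "j < n"
    then show "((alg_deriv ^^ i) (y (Suc j)) has_derivative (*) ((alg_deriv ^^ Suc i) (y (Suc j)) z)) (at z)"
      using sol[of "Suc j"] z
      by (auto simp: linear_ode_solution_def alg_differentiable_times_def alg_differentiable_iff)
  qed
  moreover have "Determinant.det (mat n n (\<lambda>(i, j). if i = k then Y (Suc i) j else Y i j))
      = M k (Y (Suc k))" for k
    unfolding M_def by (intro arg_cong[of _ _ Determinant.det] eq_matI) auto
  ultimately have deriv: "(wronskian n y has_derivative (*) (\<Sum>k<n. M k (Y (Suc k)))) (at z)"
    by (simp add: wronskian_def[abs_def])
  have dup: "M k (Y s) = 0" if "k < n" "s < n" "k \<noteq> s" for k s
    unfolding M_def using that by (rule det_row_duplicate)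
  have n: "n - 1 < n" "Suc (n - 1) = n" using \<open>n \<ge> 1\<close> by auto
  \<comment> \<open>For \<open>k < n - 1\<close> the differentiated row \<open>k\<close> repeats row
    \<open>k + 1\<close>, so only the last row contributes.\<close>
  have "(\<Sum>k<n. M k (Y (Suc k))) = (\<Sum>k\<in>{n - 1}. M k (Y (Suc k)))"
    using n dup by (intro sum.mono_neutral_right) auto
  also have "\<dots> = M (n - 1) (Y n)" using n by simp
  also have "\<dots> = M (n - 1) (\<lambda>j. \<Sum>k\<in>{1..n}. c k * Y (n - k) j)"
  proof -
    have "Y n j = (\<Sum>k\<in>{1..n}. c k * Y (n - k) j)" if "j < n" for j
    proof -
      have "(\<Sum>k\<le>n. a k z * Y (n - k) j) = 0"
        using sol[of "Suc j"] that z by (simp add: linear_ode_solution_def Y_def)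
      also have "{..n} = insert 0 {1..n}" by auto
      finally have "a 0 z * Y n j = - (\<Sum>k\<in>{1..n}. a k z * Y (n - k) j)"
        by (simp add: eq_neg_iff_add_eq_0)
      then have "w * (a 0 z * Y n j) = - w * (\<Sum>k\<in>{1..n}. a k z * Y (n - k) j)"
        by simp
      moreover have "w * (a 0 z * Y n j) = (a 0 z * w) * Y n j"
        by (simp only: mult_ac)
      moreover have "a 0 z * w = 1"
        unfolding w_def using \<open>a 0 z dvd 1\<close> by (rule alg_inverse_unit)
      ultimately show ?thesis
        by (simp add: c_def sum_distrib_left sum_negf mult.assoc)
    qed
    then show ?thesis
      unfolding M_def by (intro arg_cong[of _ _ Determinant.det] eq_matI) auto
  qed
  also have "\<dots> = (\<Sum>k\<in>{1..n}. c k * M (n - 1) (Y (n - k)))"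
    unfolding M_def using n(1) by (rule det_row_linear)
  \<comment> \<open>For \<open>k\<close> from 2 to \<open>n\<close> the inserted row
    \<open>n - k\<close> already stands above the last one. The term \<open>k = 1\<close> puts the
    original last row back, which restores the Wronskian.\<close>
  also have "\<dots> = (\<Sum>k\<in>{1}. c k * M (n - 1) (Y (n - k)))"
  proof (rule sum.mono_neutral_right)
    show "\<forall>k\<in>{1..n} - {1}. c k * M (n - 1) (Y (n - k)) = 0"
    proof
      fix k assume "k \<in> {1..n} - {1}"
      then have "n - k < n" "n - 1 \<noteq> n - k" by auto
      then show "c k * M (n - 1) (Y (n - k)) = 0" using dup n(1) by simp
    qed
  qed (use \<open>n \<ge> 1\<close> in auto)
  also have "M (n - 1) (Y (n - 1)) = wronskian n y z"
    unfolding M_def wronskian_def Y_def by (intro arg_cong[of _ _ Determinant.det] eq_matI) auto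
  then have "(\<Sum>k\<in>{1}. c k * M (n - 1) (Y (n - k))) = - (a 1 z * alg_inverse (a 0 z)) * wronskian n y z"
    by (simp add: c_def w_def mult.commute)
  finally show ?thesis using deriv by simp
qed

theorem theorem3p7:
  fixes I :: "'a::{euclidean_space, real_algebra_1, comm_ring_1} set"
    and n :: nat
    and a y :: "nat \<Rightarrow> 'a \<Rightarrow> 'a"
    and F :: "'a \<Rightarrow> 'a"
  assumes "n \<ge> 1"
    and "open I" and "connected I"
    and "\<And>k. k \<le> n \<Longrightarrow> continuous_on I (a k)"
    and "\<And>z. z \<in> I \<Longrightarrow> a 0 z dvd 1"
    and "\<And>j. 1 \<le> j \<Longrightarrow> j \<le> n \<Longrightarrow> linear_ode_solution n a I (y j)"
    and "\<And>z. z \<in> I \<Longrightarrow> alg_differentiable F z"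
    and "\<And>z. z \<in> I \<Longrightarrow> alg_deriv F z = a 1 z * alg_inverse (a 0 z)"
  shows "\<exists>C. \<forall>z\<in>I. wronskian n y z = C * alg_exp (- F z)"
proof -
  define V where "V z = wronskian n y z * alg_exp (F z)" for z
  have "(V has_derivative (\<lambda>h. 0)) (at z)" if z: "z \<in> I" for z
  proof -
    have "(F has_derivative (*) (a 1 z * alg_inverse (a 0 z))) (at z)"
      using assms(7,8)[OF z] by (simp add: alg_differentiable_iff)
    from has_derivative_compose[OF this has_derivative_alg_exp]
    have "((\<lambda>z. alg_exp (F z)) has_derivative
        (\<lambda>h. alg_exp (F z) * (a 1 z * alg_inverse (a 0 z) * h))) (at z)" .
    from has_derivative_alg_mult[OF has_derivative_wronskian[where a = a, OF assms(1) assms(5)[OF z] z assms(6)] this]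
    show ?thesis unfolding V_def[abs_def] by (simp add: algebra_simps)
  qed
  from has_derivative_zero_unique_connected[OF assms(2,3) this]
  \<comment> \<open>Connectedness gives equal values of \<open>V\<close> at any two points of
    \<open>I\<close>; if \<open>I\<close> is empty, any \<open>C\<close> will do.\<close>
  obtain C where "\<And>z. z \<in> I \<Longrightarrow> V z = C" by metis
  moreover have "wronskian n y z = V z * alg_exp (- F z)" for z
    by (simp add: V_def mult.assoc alg_exp_mult_minus)
  ultimately show ?thesis by metis
qed

end
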